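(* Let $N, M, S$ be positive integers and let $Q_{\mathrm{SYRK}}(N,M,S)$ be the minimum number of I/O operations (element transfers between slow and fast memory), over all schedules of the classical three-nested-loops SYRK algorithm computing $\mathbf{C} \mathrel{+}= \mathbf{A}\cdot \mathbf{A}^{\mathsf T}$ with $\mathbf{A}$ of size $N\times M$, on a machine with a fast memory of size $S$. Then $$Q_{\mathrm{SYRK}}(N, M, S) \geqslant \frac{1}{\sqrt{2}}\, \frac{N^{2}M}{\sqrt{S}}.$$
   Context: Machine model: there is a slow memory of unbounded size, which initially holds all the data, and a fast memory that can hold at most $S$ matrix elements. An elementary operation can be performed only if all its operands are in fast memory. The schedule explicitly controls which elements are loaded into and removed from the fast memory. An I/O operation (data access) is the transfer of one element between slow and fast memory. SYRK algorithm: $\mathbf{A}$ is an $N\times M$ matrix and $\mathbf{C}$ is a symmetric $N\times N$ matrix of which only the lower triangular part is referenced and computed. The elementary operations are, for $1\le i\le N$, $1\le j\le i$, $1\le k\le M$, $$\mathbf{C}_{i,j} \mathrel{+}= \mathbf{A}_{i,k}\cdot \mathbf{A}_{j,k},$$ with operands $\mathbf{C}_{i,j}$, $\mathbf{A}_{i,k}$, $\mathbf{A}_{j,k}$. The set of operations is fixed. A schedule is an ordering of these operations respecting data dependencies, together with the loads and removals of elements in fast memory. The same loaded element of $\mathbf{A}$ may be used both as $\mathbf{A}_{i,k}$ and as $\mathbf{A}_{j,k}$ in different operations. *)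

theory Defs
  imports Complex_Main "HOL-Library.Extended_Real"
begin

text \<open>Entries carry their 1-based indices. \<open>EltC i j\<close> is only used for \<open>j \<le> i\<close>.\<close>

datatype elt = EltA nat nat | EltC nat nat

definition syrk_data :: "nat \<Rightarrow> nat \<Rightarrow> elt set" where
  "syrk_data N M =
     {EltA i k | i k. 1 \<le> i \<and> i \<le> N \<and> 1 \<le> k \<and> k \<le> M} \<union>
     {EltC i j | i j. 1 \<le> j \<and> j \<le> i \<and> i \<le> N}"

text \<open>The triple \<open>(i, j, k)\<close> stands for the update \<open>C i j += A i k * A j k\<close>.\<close>

type_synonym syrk_op = "nat \<times> nat \<times> nat"

definition syrk_ops :: "nat \<Rightarrow> nat \<Rightarrow> syrk_op set" where
  "syrk_ops N M = {(i, j, k). 1 \<le> i \<and> i \<le> N \<and> 1 \<le> j \<and> j \<le> i \<and> 1 \<le> k \<and> k \<le> M}"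

text \<open>A set, so a diagonal update has only two operands.\<close>

fun operands :: "syrk_op \<Rightarrow> elt set" where
  "operands (i, j, k) = {EltC i j, EltA i k, EltA j k}"

fun target :: "syrk_op \<Rightarrow> elt" where
  "target (i, j, k) = EltC i j"

text \<open>
  Removing an element from fast memory is \<open>Discard\<close>, which moves no data; copying its value
  back to slow memory is the separate transfer \<open>Store\<close>.
\<close>

datatype instr = Load elt | Store elt | Discard elt | Compute syrk_op

text \<open>
  \<open>F\<close> is the content of fast memory and \<open>D \<subseteq> F\<close> the set of elements whose copy in slow memory
  is out of date. A modified element must be stored before it is discarded, so that every update
  of an entry of \<open>C\<close> acts on the value accumulated so far. This is the only data dependency:
  the updates of one entry may be performed in any order.
  The final values are not required to be stored.
\<close>

fun legal :: "nat \<Rightarrow> nat \<Rightarrow> nat \<Rightarrow> elt set \<Rightarrow> elt set \<Rightarrow> instr list \<Rightarrow> bool" where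
  "legal N M S F D [] \<longleftrightarrow> True"
| "legal N M S F D (Load x # p) \<longleftrightarrow>
     x \<in> syrk_data N M \<and> x \<notin> F \<and> card (insert x F) \<le> S \<and> legal N M S (insert x F) D p"
| "legal N M S F D (Store x # p) \<longleftrightarrow> x \<in> F \<and> legal N M S F (D - {x}) p"
| "legal N M S F D (Discard x # p) \<longleftrightarrow> x \<in> F \<and> x \<notin> D \<and> legal N M S (F - {x}) D p"
| "legal N M S F D (Compute t # p) \<longleftrightarrow>
     operands t \<subseteq> F \<and> legal N M S F (insert (target t) D) p"

fun computed :: "instr list \<Rightarrow> syrk_op list" where
  "computed [] = []"
| "computed (Compute t # p) = t # computed p"
| "computed (_ # p) = computed p"

definition syrk_schedules :: "nat \<Rightarrow> nat \<Rightarrow> nat \<Rightarrow> instr list set" where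
  "syrk_schedules N M S =
     {p. legal N M S {} {} p \<and> distinct (computed p) \<and> set (computed p) = syrk_ops N M}"

fun is_transfer :: "instr \<Rightarrow> bool" where
  "is_transfer (Load x) = True"
| "is_transfer (Store x) = True"
| "is_transfer (Discard x) = False"
| "is_transfer (Compute t) = False"

definition io_count :: "instr list \<Rightarrow> nat" where
  "io_count p = length (filter is_transfer p)"

text \<open>
  The infimum is attained whenever a schedule exists; it is \<open>\<infinity>\<close> if fast memory
  is too small to hold the operands of some operation.
\<close>

definition Q_SYRK :: "nat \<Rightarrow> nat \<Rightarrow> nat \<Rightarrow> enat" where
  "Q_SYRK N M S = (INF p \<in> syrk_schedules N M S. enat (io_count p))"

end

theory Submission
  imports Defs "HOL-Analysis.Convex"
begin

text \<open>
  Count every off-diagonal update twice, as \<open>(i, j, k)\<close> and as \<open>(j, i, k)\<close>, and every diagonal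
  one once; the total is exactly \<open>N\<^sup>2 M\<close>. A phase touching \<open>c\<close> entries of \<open>C\<close> and \<open>a\<close> entries of
  \<open>A\<close> performs, by the Loomis--Whitney inequality, at most \<open>sqrt (2 c a\<^sup>2)\<close> updates in this
  count, and \<open>27 a\<^sup>2 c \<le> 4 (a + c)\<^sup>3\<close>. Hence a phase touching \<open>X \<le> 3 S\<close> elements accounts for at
  most \<open>sqrt (8 S / 9) * X\<close> updates. Cutting the schedule after every \<open>2 S\<close> loads, a phase touches at
  most \<open>S\<close> elements more than it loads, and the first phase none more. With \<open>L\<close> loads in total,
  the \<open>X\<close> therefore add up to at most \<open>L + S * (L / (2 S)) = 3 / 2 * L\<close>, with no rounding loss.
\<close>

text \<open>Slice \<open>E\<close> into fibres \<open>K (i, j)\<close> over \<open>P\<close>. The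
  squared fibre sizes sum to at most \<open>card Q * card R\<close>, and Cauchy-Schwarz over
  \<open>P\<close> turns this into a bound on \<open>(card E)\<^sup>2\<close>.\<close>

lemma Loomis_Whitney_3:
  fixes P :: "('a \<times> 'b) set" and Q :: "('a \<times> 'c) set" and R :: "('b \<times> 'c) set"
  assumes fin: "finite P" "finite Q" "finite R"
    and E: "\<And>i j k. (i, j, k) \<in> E \<Longrightarrow> (i, j) \<in> P \<and> (i, k) \<in> Q \<and> (j, k) \<in> R"
  shows "(card E)\<^sup>2 \<le> card P * card Q * card R"
proof -
  define K where "K = (\<lambda>(i, j). {k. (i, j, k) \<in> E})"
  have K_sub: "K x \<subseteq> snd ` Q" for x
    using E by (force simp: K_def split: prod.splits)
  have finK: "finite (K x)" for x
    using K_sub fin(2) by (meson finite_imageI finite_subset)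
  have E_eq: "E = (\<lambda>((i, j), k). (i, j, k)) ` (SIGMA x:P. K x)"
    using E by (force simp: K_def image_iff)
  have inj: "inj_on (\<lambda>((i, j), k). (i, j, k)) (SIGMA x:P. K x)"
    by (auto simp: inj_on_def)
  have card_E: "card E = (\<Sum>x\<in>P. card (K x))"
    unfolding E_eq card_image[OF inj] using fin(1) finK by (simp add: card_SigmaI)
  let ?pairs = "SIGMA x:P. K x \<times> K x"
  have "(\<Sum>x\<in>P. (card (K x))\<^sup>2) = card ?pairs"
    using fin(1) finK by (simp add: card_SigmaI card_cartesian_product power2_eq_square)
  also have "\<dots> \<le> card (Q \<times> R)"
  proof (rule card_inj_on_le)
    \<comment> \<open>Two points \<open>(i, j, k)\<close> and \<open>(i, j, l)\<close> of one fibre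
      are recovered from the \<open>Q\<close>-projection of the first and the
      \<open>R\<close>-projection of the second.\<close>
    show "inj_on (\<lambda>((i, j), k, l). ((i, k), (j, l))) ?pairs"
      by (auto simp: inj_on_def)
    show "(\<lambda>((i, j), k, l). ((i, k), (j, l))) ` ?pairs \<subseteq> Q \<times> R"
      using E by (force simp: K_def)
  qed (use fin in auto)
  finally have squares: "(\<Sum>x\<in>P. (card (K x))\<^sup>2) \<le> card Q * card R"
    by (simp add: card_cartesian_product)
  have "real ((card E)\<^sup>2) = (\<Sum>x\<in>P. real (card (K x)))\<^sup>2"
    by (simp add: card_E)
  also have "\<dots> \<le> (\<Sum>x\<in>P. (real (card (K x)))\<^sup>2) * card P"
    by (rule sum_squared_le_sum_of_squares)
  also have "\<dots> = real ((\<Sum>x\<in>P. (card (K x))\<^sup>2) * card P)"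
    by simp
  also have "\<dots> \<le> real (card Q * card R * card P)"
    using squares mult_le_mono1 of_nat_le_iff by blast
  finally show ?thesis
    by (simp only: of_nat_le_iff ac_simps)
qed

definition sym_ops :: "syrk_op set \<Rightarrow> syrk_op set" where
  "sym_ops E = E \<union> (\<lambda>(i, j, k). (j, i, k)) ` E"

lemma sym_ops_Un: "sym_ops (E \<union> E') = sym_ops E \<union> sym_ops E'"
  unfolding sym_ops_def by (simp add: image_Un Un_ac)

lemma card_sym_ops_syrk_ops: "card (sym_ops (syrk_ops N M)) = N\<^sup>2 * M"
proof -
  have "sym_ops (syrk_ops N M) = {1..N} \<times> {1..N} \<times> {1..M}"
    by (auto simp: sym_ops_def syrk_ops_def image_iff)
  then show ?thesis
    by (simp add: card_cartesian_product power2_eq_square)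
qed

text \<open>This is AM-GM for \<open>a / 2\<close>, \<open>a / 2\<close>, \<open>c\<close>; equality
  at \<open>a = 2 * c\<close> explains the squared factor in the proof.\<close>

lemma AM_GM_cubic:
  fixes a c :: real
  assumes "a \<ge> 0" "c \<ge> 0"
  shows "27 * (a\<^sup>2 * c) \<le> 4 * (a + c) ^ 3"
proof -
  have "4 * (a + c) ^ 3 - 27 * (a\<^sup>2 * c) = (a - 2 * c)\<^sup>2 * (4 * a + c)"
    by (simp add: power2_eq_square power3_eq_cube algebra_simps)
  moreover have "\<dots> \<ge> 0"
    using assms by simp
  ultimately show ?thesis by linarith
qed

text \<open>The bound is linear in \<open>card U\<close> so that the bounds of successive phases can
  be added.\<close>

lemma card_sym_ops_le:
  fixes S :: nat
  assumes fin: "finite U" and card_U: "card U \<le> 3 * S"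
    and ops: "\<And>t. t \<in> E \<Longrightarrow> operands t \<subseteq> U"
  shows "card (sym_ops E) \<le> sqrt (8 * S / 9) * card U"
proof -
  define C where "C = {(i, j). EltC i j \<in> U}"
  define A where "A = {(i, k). EltA i k \<in> U}"
  let ?c = "case_prod EltC ` C" and ?a = "case_prod EltA ` A"
  have inj: "inj_on (case_prod EltC) C" "inj_on (case_prod EltA) A"
    by (auto simp: inj_on_def)
  have sub: "?c \<subseteq> U" "?a \<subseteq> U" "?c \<inter> ?a = {}"
    by (auto simp: C_def A_def)
  then have finCA: "finite C" "finite A"
    using fin inj by (meson finite_imageD finite_subset)+
  have "card C + card A = card (?c \<union> ?a)"
    using sub(3) finCA by (simp add: card_Un_disjoint card_image inj)
  also have "\<dots> \<le> card U"
    using sub fin by (intro card_mono) auto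
  finally have sum_le: "card C + card A \<le> card U" .
  \<comment> \<open>Mirrored updates project to transposed entries of \<open>C\<close>, which costs
    a factor 2, while both other projections stay inside the same set \<open>A\<close>.\<close>
  let ?P = "C \<union> prod.swap ` C"
  have P: "finite ?P" "card ?P \<le> 2 * card C"
    using finCA card_Un_le[of C "prod.swap ` C"] card_image_le[of C prod.swap] by auto
  have proj: "(i, j) \<in> ?P \<and> (i, k) \<in> A \<and> (j, k) \<in> A" if "(i, j, k) \<in> sym_ops E" for i j k
    using that ops by (fastforce simp: sym_ops_def C_def A_def image_iff)
  note LW = Loomis_Whitney_3[OF P(1) finCA(2) finCA(2) proj]
  define x where "x = real (card U)"
  have x: "0 \<le> x" "x \<le> 3 * S" "real (card A) + real (card C) \<le> x"
    using card_U sum_le by (auto simp: x_def)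
  have "(card (sym_ops E))\<^sup>2 \<le> 2 * card C * card A * card A"
    using LW P(2) by (meson le_trans mult_le_mono1)
  then have "real ((card (sym_ops E))\<^sup>2) \<le> real (2 * card C * card A * card A)"
    by (simp only: of_nat_le_iff)
  also have "\<dots> = 2 * ((real (card A))\<^sup>2 * real (card C))"
    by (simp add: power2_eq_square)
  also have "\<dots> \<le> 8 / 27 * (real (card A) + real (card C)) ^ 3"
    using AM_GM_cubic[of "real (card A)" "real (card C)"]
    by (simp add: ac_simps)
  also have "\<dots> \<le> 8 / 27 * x ^ 3"
    using x by (intro mult_left_mono power_mono) auto
  also have "x ^ 3 = x * x\<^sup>2"
    by (simp add: power2_eq_square power3_eq_cube)
  \<comment> \<open>Only one factor \<open>x\<close> is replaced by \<open>3 * S\<close>; the square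
    root of the rest is linear in \<open>x\<close>.\<close>
  also have "8 / 27 * (x * x\<^sup>2) \<le> 8 / 27 * (3 * S * x\<^sup>2)"
    using x(2) by (intro mult_left_mono mult_right_mono) auto
  also have "\<dots> = (sqrt (8 * S / 9) * x)\<^sup>2"
    by (simp add: power_mult_distrib)
  finally have "(real (card (sym_ops E)))\<^sup>2 \<le> (sqrt (8 * S / 9) * x)\<^sup>2"
    by simp
  then show ?thesis
    unfolding x_def by (rule power2_le_imp_le) simp
qed

text \<open>Stores are left out: the lower bound is obtained from loads alone. Repeated loads of one
  element are kept.\<close>

fun loaded :: "instr list \<Rightarrow> elt list" where
  "loaded [] = []"
| "loaded (Load x # p) = x # loaded p"
| "loaded (_ # p) = loaded p"

lemma loaded_append [simp]: "loaded (p @ q) = loaded p @ loaded q"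
  by (induction p rule: loaded.induct) auto

lemma computed_append [simp]: "computed (p @ q) = computed p @ computed q"
  by (induction p rule: computed.induct) auto

lemma length_loaded_le_io_count: "length (loaded p) \<le> io_count p"
  by (induction p rule: loaded.induct) (auto simp: io_count_def)

text \<open>A discrete intermediate value argument: each instruction adds at most one load.\<close>

lemma split_at_loads:
  "n \<le> length (loaded p) \<Longrightarrow> \<exists>p\<^sub>1 p\<^sub>2. p = p\<^sub>1 @ p\<^sub>2 \<and> length (loaded p\<^sub>1) = n"
proof (induction p arbitrary: n rule: rev_induct)
  case (snoc y p)
  show ?case
  proof (cases "n \<le> length (loaded p)")
    case True
    then show ?thesis using snoc.IH by (metis append_assoc)
  next
    case False
    then have "n = length (loaded (p @ [y]))"
      using snoc.prems by (cases y) auto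
    then show ?thesis by (metis append_Nil2)
  qed
qed simp

text \<open>Allows the induction over phases to restart from whatever fast memory holds at a
  cut.\<close>

lemma legal_appendD:
  assumes "legal N M S F D (p @ q)" "finite F" "card F \<le> S"
  obtains F' D' where "legal N M S F' D' q" "finite F'" "card F' \<le> S"
proof -
  have "\<exists>F' D'. legal N M S F' D' q \<and> finite F' \<and> card F' \<le> S"
    using assms
  proof (induction p arbitrary: F D)
    case (Cons y p)
    show ?case
    proof (cases y)
      case (Load x)
      then show ?thesis using Cons.prems by (intro Cons.IH[of "insert x F" D]) auto
    next
      case (Store x)
      then show ?thesis using Cons.prems by (intro Cons.IH[of F "D - {x}"]) auto
    next
      case (Discard x)
      have "card (F - {x}) \<le> S"
        using Cons.prems(3) card_Diff1_le[of F x] by linarith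
      with Discard Cons.prems show ?thesis by (intro Cons.IH[of "F - {x}" D]) auto
    next
      case (Compute t)
      then show ?thesis using Cons.prems by (intro Cons.IH[of F "insert (target t) D"]) auto
    qed
  qed auto
  then show ?thesis using that by blast
qed

lemma legal_append1: "legal N M S F D (p @ q) \<Longrightarrow> legal N M S F D p"
  by (induction N M S F D p rule: legal.induct) auto

lemma legal_operands:
  "legal N M S F D p \<Longrightarrow> t \<in> set (computed p) \<Longrightarrow> operands t \<subseteq> F \<union> set (loaded p)"
  by (induction N M S F D p rule: legal.induct) auto

text \<open>The initial content \<open>F\<close> is arbitrary for the induction; its term vanishes
  for a schedule that starts with empty fast memory.\<close>

lemma card_sym_ops_computed_le:
  assumes "legal N M S F D p" "finite F" "card F \<le> S" "S > 0"
  shows "card (sym_ops (set (computed p))) \<le> sqrt (8 * S / 9) * (card F + 3 / 2 * length (loaded p))"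
  using assms
proof (induction "length (loaded p)" arbitrary: p F D rule: less_induct)
  case less
  have phase: "card (sym_ops (set (computed q))) \<le> sqrt (8 * S / 9) * (card F + length (loaded q))"
    if "p = q @ r" "length (loaded q) \<le> 2 * S" for q r
  proof -
    let ?U = "F \<union> set (loaded q)"
    have "legal N M S F D q"
      using less.prems(1) that(1) legal_append1 by blast
    then have ops: "operands t \<subseteq> ?U" if "t \<in> set (computed q)" for t
      using that by (rule legal_operands)
    have card_U: "card ?U \<le> card F + length (loaded q)"
      by (meson add_left_mono card_Un_le card_length le_trans)
    have "card (sym_ops (set (computed q))) \<le> sqrt (8 * S / 9) * card ?U"
    proof (rule card_sym_ops_le)
      show "finite ?U" using less.prems(2) by simp
      show "card ?U \<le> 3 * S" using less.prems(3) that(2) card_U by linarith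
    qed (rule ops)
    also have "\<dots> \<le> sqrt (8 * S / 9) * (card F + length (loaded q))"
      using card_U by (intro mult_left_mono) auto
    finally show ?thesis by simp
  qed
  show ?case
  proof (cases "length (loaded p) \<le> 2 * S")
    case True
    have "sqrt (8 * S / 9) * (card F + length (loaded p))
        \<le> sqrt (8 * S / 9) * (card F + 3 / 2 * length (loaded p))"
      by (intro mult_left_mono) auto
    with phase[of p "[]"] True show ?thesis by simp
  next
    case False
    then obtain q r where p: "p = q @ r" and q: "length (loaded q) = 2 * S"
      using split_at_loads[of "2 * S" p] by auto
    obtain F' D' where r: "legal N M S F' D' r" "finite F'" "card F' \<le> S"
      using legal_appendD less.prems p by metis
    have "card (sym_ops (set (computed r)))
        \<le> sqrt (8 * S / 9) * (card F' + 3 / 2 * length (loaded r))"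
      using less.hyps[OF _ r] p q \<open>S > 0\<close> by simp
    also have "\<dots> \<le> sqrt (8 * S / 9) * (S + 3 / 2 * length (loaded r))"
      using r(3) by (intro mult_left_mono) auto
    finally have rest: "card (sym_ops (set (computed r))) \<le> \<dots>" .
    have "card (sym_ops (set (computed p)))
        \<le> card (sym_ops (set (computed q))) + card (sym_ops (set (computed r)))"
      unfolding p by (simp add: sym_ops_Un card_Un_le)
    then have "card (sym_ops (set (computed p)))
        \<le> sqrt (8 * S / 9) * (card F + 2 * S) + sqrt (8 * S / 9) * (S + 3 / 2 * length (loaded r))"
      using phase[OF p] q rest by simp
    \<comment> \<open>The \<open>S\<close> elements that the rest may inherit are charged to the
      \<open>2 * S\<close> loads of \<open>q\<close>:
      \<open>2 * S + S = 3 / 2 * (2 * S)\<close>.\<close>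
    also have "\<dots> = sqrt (8 * S / 9) * (card F + 3 / 2 * length (loaded p))"
      unfolding p using q by (simp add: field_simps)
    finally show ?thesis by simp
  qed
qed

lemma io_count_ge:
  assumes "p \<in> syrk_schedules N M S" "S > 0"
  shows "1 / sqrt 2 * ((real N)\<^sup>2 * real M / sqrt (real S)) \<le> real (io_count p)"
proof -
  have p: "legal N M S {} {} p" "set (computed p) = syrk_ops N M"
    using assms by (auto simp: syrk_schedules_def)
  have "(real N)\<^sup>2 * real M = real (card (sym_ops (set (computed p))))"
    by (simp add: p(2) card_sym_ops_syrk_ops)
  also have "\<dots> \<le> sqrt (8 * S / 9) * (3 / 2 * length (loaded p))"
    using card_sym_ops_computed_le[OF p(1)] \<open>S > 0\<close> by simp
  also have "sqrt (8 * S / 9) = 2 / 3 * (sqrt 2 * sqrt S)"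
    by (rule real_sqrt_unique) (simp_all add: power_mult_distrib power_divide)
  also have "2 / 3 * (sqrt 2 * sqrt S) * (3 / 2 * length (loaded p))
      = sqrt 2 * sqrt S * length (loaded p)"
    by simp
  also have "\<dots> \<le> sqrt 2 * sqrt S * io_count p"
    using length_loaded_le_io_count[of p] by (intro mult_left_mono) auto
  finally show ?thesis
    using \<open>S > 0\<close> by (simp add: field_simps)
qed

theorem corollary4p7:
  fixes N M S :: nat
  assumes "N > 0" and "M > 0" and "S > 0"
  shows "ereal_of_enat (Q_SYRK N M S)
           \<ge> ereal (1 / sqrt 2 * ((real N)\<^sup>2 * real M / sqrt (real S)))"
proof (cases "syrk_schedules N M S = {}")
  case True
  then show ?thesis
    by (simp add: Q_SYRK_def top_enat_def)
next
  case False
  then obtain p\<^sub>0 where "p\<^sub>0 \<in> syrk_schedules N M S"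
    by blast
  \<comment> \<open>\<open>enat\<close> is well-ordered, so the infimum over a nonempty set is
    attained.\<close>
  then have "Q_SYRK N M S \<in> (\<lambda>p. enat (io_count p)) ` syrk_schedules N M S"
    unfolding Q_SYRK_def by (rule wellorder_InfI[OF imageI])
  then obtain p where "p \<in> syrk_schedules N M S" "Q_SYRK N M S = enat (io_count p)"
    by blast
  then show ?thesis
    using io_count_ge[OF _ \<open>S > 0\<close>] by simp
qed

end
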